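(* There is an absolute constant $c>0$ such that for every $n\ge 1$ and every Boolean function $f:\{0,1\}^n\to\{0,1\}$, $\mathsf{EC}(f)\le c\cdot\max\{1,\mathsf{DT}(f)\}^3$; that is, $\mathsf{EC}(f)\le O(\mathsf{DT}(f)^3)$.
   Context: A Boolean circuit $C$ over the basis $\mathcal{B}=\{\land_2,\lor_2,\lnot\}$ (AND and OR of fan-in 2, and NOT) is a directed acyclic graph with a root node of out-degree zero, input gates (in-degree zero) labeled by variables $x_1,\dots,x_n$, and non-input gates (including the root) labeled by functions in $\mathcal{B}$; gates may have arbitrary fan-out. For an input $a\in\{0,1\}^n$, $\mathsf{EC}(C,a)$ is the number of non-input gates of $C$ that output $1$ on $a$; $\mathsf{EC}(C)=\max_{a}\mathsf{EC}(C,a)$; and $\mathsf{EC}(f)$ is the minimum of $\mathsf{EC}(C)$ over all circuits $C$ over $\mathcal{B}$ computing $f$. There is no restriction on circuit size. A decision tree is a rooted binary tree whose internal nodes query variables and whose leaves are labeled $0$ or $1$; each input determines a root-to-leaf path, and the tree computes $f$ if for every input $a$ the leaf reached is labeled $f(a)$. Its depth is the length of the longest root-to-leaf path. $\mathsf{DT}(f)$ is the minimum depth of a decision tree computing $f$. *)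

theory Defs
  imports Complex_Main
begin

text \<open>Points of \<open>{0,1}\<^sup>n\<close> are the Boolean lists of length \<open>n\<close>, and the variable \<open>x\<^sub>i\<^sub>+\<^sub>1\<close> is \<open>a ! i\<close>.
  A Boolean function on \<open>{0,1}\<^sup>n\<close> is a function on lists of which only the values on \<open>cube n\<close> matter.\<close>

definition cube :: "nat \<Rightarrow> bool list set" where
  "cube n = {a. length a = n}"

text \<open>A gate carries its label together with the origins of its incoming wires.
  The two wires of a binary gate may come from the same node.\<close>

datatype (preds: 'v) gate =
    Input nat
  | Not_Gate 'v
  | And_Gate 'v 'v
  | Or_Gate 'v 'v

record circuit =
  nodes :: "nat set"
  label :: "nat \<Rightarrow> nat gate"
  root :: nat

definition wires :: "circuit \<Rightarrow> (nat \<times> nat) set" where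
  "wires C = {(u, v). v \<in> nodes C \<and> u \<in> preds (label C v)}"

definition noninput_gates :: "circuit \<Rightarrow> nat set" where
  "noninput_gates C = {v \<in> nodes C. \<forall>i. label C v \<noteq> Input i}"

definition is_circuit :: "nat \<Rightarrow> circuit \<Rightarrow> bool" where
  "is_circuit n C \<longleftrightarrow>
     finite (nodes C) \<and>
     wires C \<subseteq> nodes C \<times> nodes C \<and>
     acyclic (wires C) \<and>
     (\<forall>v\<in>nodes C. \<forall>i. label C v = Input i \<longrightarrow> i < n) \<and>
     root C \<in> noninput_gates C \<and>
     (\<forall>v. (root C, v) \<notin> wires C)"

text \<open>\<open>outputs C a v b\<close>: gate \<open>v\<close> of \<open>C\<close> outputs \<open>b\<close> on input \<open>a\<close>.\<close>

inductive outputs :: "circuit \<Rightarrow> bool list \<Rightarrow> nat \<Rightarrow> bool \<Rightarrow> bool" for C a where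
  outputs_Input: "label C v = Input i \<Longrightarrow> outputs C a v (a ! i)"
| outputs_Not: "label C v = Not_Gate u \<Longrightarrow> outputs C a u b \<Longrightarrow> outputs C a v (\<not> b)"
| outputs_And: "label C v = And_Gate u w \<Longrightarrow> outputs C a u b \<Longrightarrow> outputs C a w b'
    \<Longrightarrow> outputs C a v (b \<and> b')"
| outputs_Or: "label C v = Or_Gate u w \<Longrightarrow> outputs C a u b \<Longrightarrow> outputs C a w b'
    \<Longrightarrow> outputs C a v (b \<or> b')"

lemma outputs_unique: "outputs C a v b \<Longrightarrow> outputs C a v b' \<Longrightarrow> b = b'"
proof (induction arbitrary: b' rule: outputs.induct)
  case outputs_Input
  from outputs_Input(2) show ?case
    by (rule outputs.cases) (use outputs_Input(1) in auto)
next
  case outputs_Not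
  from outputs_Not(4) show ?case
    by (rule outputs.cases) (use outputs_Not(1,3) in auto)
next
  case outputs_And
  from outputs_And(6) show ?case
    by (rule outputs.cases) (use outputs_And(1,4,5) in auto)
next
  case outputs_Or
  from outputs_Or(6) show ?case
    by (rule outputs.cases) (use outputs_Or(1,4,5) in auto)
qed

lemma outputs_total:
  assumes C: "is_circuit n C" and "v \<in> nodes C"
  shows "\<exists>!b. outputs C a v b"
proof -
  have sub: "wires C \<subseteq> nodes C \<times> nodes C" and "finite (nodes C)" and ac: "acyclic (wires C)"
    using C by (auto simp: is_circuit_def)
  then have "finite (wires C)"
    by (meson finite_SigmaI finite_subset)
  then have "wf (wires C)"
    using ac by (rule finite_acyclic_wf)
  then have "v \<in> nodes C \<longrightarrow> (\<exists>b. outputs C a v b)"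
  proof (induction v rule: wf_induct_rule)
    case (less v)
    show ?case
    proof
      assume v: "v \<in> nodes C"
      have "\<exists>b. outputs C a u b" if "u \<in> preds (label C v)" for u
      proof -
        have "(u, v) \<in> wires C" using v that by (simp add: wires_def)
        then show ?thesis using less sub by blast
      qed
      then show "\<exists>b. outputs C a v b"
        by (cases "label C v") (simp; metis outputs.intros)+
    qed
  qed
  then show ?thesis
    using assms(2) outputs_unique by blast
qed

definition circuit_computes :: "nat \<Rightarrow> circuit \<Rightarrow> (bool list \<Rightarrow> bool) \<Rightarrow> bool" where
  "circuit_computes n C f \<longleftrightarrow> (\<forall>a\<in>cube n. outputs C a (root C) (f a))"

definition energy_at :: "circuit \<Rightarrow> bool list \<Rightarrow> nat" where
  "energy_at C a = card {v \<in> noninput_gates C. outputs C a v True}"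

definition energy :: "nat \<Rightarrow> circuit \<Rightarrow> nat" where
  "energy n C = Max (energy_at C ` cube n)"

text \<open>The minimum below is attained for \<open>n \<ge> 1\<close>; for \<open>n = 0\<close> there are no circuits, since every
  circuit has input gates.\<close>

definition EC :: "nat \<Rightarrow> (bool list \<Rightarrow> bool) \<Rightarrow> nat" where
  "EC n f = (LEAST k. \<exists>C. is_circuit n C \<and> circuit_computes n C f \<and> energy n C = k)"

text \<open>In \<open>Query i l r\<close> the subtree \<open>l\<close> is entered when the queried variable is 0, and \<open>r\<close> when it
  is 1.\<close>

datatype dtree = Leaf bool | Query nat dtree dtree

primrec queried :: "dtree \<Rightarrow> nat set" where
  "queried (Leaf b) = {}"
| "queried (Query i l r) = insert i (queried l \<union> queried r)"

primrec dtree_eval :: "dtree \<Rightarrow> bool list \<Rightarrow> bool" where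
  "dtree_eval (Leaf b) a = b"
| "dtree_eval (Query i l r) a = (if a ! i then dtree_eval r a else dtree_eval l a)"

primrec dtree_depth :: "dtree \<Rightarrow> nat" where
  "dtree_depth (Leaf b) = 0"
| "dtree_depth (Query i l r) = Suc (max (dtree_depth l) (dtree_depth r))"

definition dtree_computes :: "nat \<Rightarrow> dtree \<Rightarrow> (bool list \<Rightarrow> bool) \<Rightarrow> bool" where
  "dtree_computes n T f \<longleftrightarrow> queried T \<subseteq> {..<n} \<and> (\<forall>a\<in>cube n. dtree_eval T a = f a)"

definition DT :: "nat \<Rightarrow> (bool list \<Rightarrow> bool) \<Rightarrow> nat" where
  "DT n f = (LEAST d. \<exists>T. dtree_computes n T f \<and> dtree_depth T = d)"

end

theory Submission
  imports Defs
begin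

text \<open>Pad an optimal decision tree to a perfect binary tree of depth \<open>D\<close>. Testing for every tree node
  whether the queried variable is 0 would need one negation per variable, and most of these negations
  could output 1. But exactly one node of each level lies on the path of the input, so the bit read at
  level \<open>k\<close> is the disjunction, over all nodes of that level, of ``node is reached and its variable
  is 1''. A single negation per level then suffices. If the disjunction is arranged along the decision
  tree itself, only the gates on the path of the input output 1, which gives energy
  \<open>O(D\<^sup>2)\<close>.\<close>

section \<open>Circuits over arbitrary gate names\<close>

primrec gate_value :: "bool list \<Rightarrow> ('v \<Rightarrow> bool) \<Rightarrow> 'v gate \<Rightarrow> bool" where
  "gate_value a val (Input i) = a ! i"
| "gate_value a val (Not_Gate u) = (\<not> val u)"
| "gate_value a val (And_Gate u w) = (val u \<and> val w)"
| "gate_value a val (Or_Gate u w) = (val u \<or> val w)"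

lemma finite_cube: "finite (cube n)"
  using finite_lists_length_eq[of "UNIV :: bool set" n] by (simp add: cube_def)

lemma cube_nonempty: "cube n \<noteq> {}"
  by (auto simp: cube_def intro: Ex_list_of_length)

lemma EC_le:
  assumes C: "is_circuit n C" "circuit_computes n C f"
    and K: "\<And>a. a \<in> cube n \<Longrightarrow> energy_at C a \<le> K"
  shows "EC n f \<le> K"
proof -
  have "EC n f \<le> energy n C"
    unfolding EC_def using C by (intro Least_le) blast
  also have "\<dots> \<le> K"
    unfolding energy_def using K finite_cube cube_nonempty by (subst Max_le_iff) auto
  finally show ?thesis .
qed

text \<open>Reduces an energy bound to local checks on gates of any type: a strictly increasing
  \<open>rank\<close> rules out cycles, and induction on it shows that a valuation consistent at
  every gate gives the actual outputs.\<close>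

lemma EC_le_card_gates:
  fixes G :: "'g set" and lab :: "'g \<Rightarrow> 'g gate" and rank :: "'g \<Rightarrow> nat"
  assumes fin: "finite G"
    and closed: "\<And>g h. g \<in> G \<Longrightarrow> h \<in> preds (lab g) \<Longrightarrow> h \<in> G"
    and rank: "\<And>g h. g \<in> G \<Longrightarrow> h \<in> preds (lab g) \<Longrightarrow> rank h < rank g"
    and inputs: "\<And>g i. g \<in> G \<Longrightarrow> lab g = Input i \<Longrightarrow> i < n"
    and root: "r \<in> G" "\<And>i. lab r \<noteq> Input i" "\<And>g. g \<in> G \<Longrightarrow> r \<notin> preds (lab g)"
    and val: "\<And>a g. a \<in> cube n \<Longrightarrow> g \<in> G \<Longrightarrow> val a g = gate_value a (val a) (lab g)"
    and f: "\<And>a. a \<in> cube n \<Longrightarrow> val a r = f a"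
    and K: "\<And>a. a \<in> cube n \<Longrightarrow> card {g \<in> G. (\<forall>i. lab g \<noteq> Input i) \<and> val a g} \<le> K"
  shows "EC n f \<le> K"
proof -
  obtain e :: "'g \<Rightarrow> nat" where e: "inj_on e G"
    using finite_imp_inj_to_nat_seg[OF fin] by blast
  define C where "C = \<lparr>nodes = e ` G, label = (\<lambda>v. map_gate e (lab (inv_into G e v))), root = e r\<rparr>"
  have nodes: "nodes C = e ` G" and root_C: "root C = e r"
    by (simp_all add: C_def)
  have label: "label C (e g) = map_gate e (lab g)" if "g \<in> G" for g
    using that e by (simp add: C_def)
  have label_Input: "label C (e g) = Input i \<longleftrightarrow> lab g = Input i" if "g \<in> G" for g i
    using that by (cases "lab g") (simp_all add: label)
  have wires: "wires C = {(e h, e g) | h g. g \<in> G \<and> h \<in> preds (lab g)}"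
    unfolding wires_def nodes by (auto simp: label gate.set_map) blast
  have "wires C \<subseteq> measure (\<lambda>v. rank (inv_into G e v))"
    unfolding wires using e closed rank by auto
  then have "acyclic (wires C)"
    by (meson wf_acyclic wf_measure wf_subset)
  moreover have noninput: "noninput_gates C = e ` {g \<in> G. \<forall>i. lab g \<noteq> Input i}"
    unfolding noninput_gates_def nodes by (auto simp: label_Input)
  moreover have "(e r, v) \<notin> wires C" for v
    unfolding wires using e root closed by (auto dest: inj_onD)
  ultimately have circuit: "is_circuit n C"
    unfolding is_circuit_def root_C
    using fin root inputs closed by (auto simp: nodes label_Input wires)
  have outputs: "outputs C a (e g) (val a g)" if a: "a \<in> cube n" and "g \<in> G" for a g
    using that(2)
  proof (induction "rank g" arbitrary: g rule: less_induct)
    case less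
    have IH: "outputs C a (e h) (val a h)" if "h \<in> preds (lab g)" for h
      using that less closed rank by blast
    show ?case
      using IH val[OF a less.prems] label[OF less.prems]
      by (cases "lab g") (auto intro: outputs.intros)
  qed
  then have "circuit_computes n C f"
    unfolding circuit_computes_def root_C using root(1) by (auto simp flip: f)
  moreover have "energy_at C a \<le> K" if a: "a \<in> cube n" for a
  proof -
    have "{v \<in> noninput_gates C. outputs C a v True}
        = e ` {g \<in> G. (\<forall>i. lab g \<noteq> Input i) \<and> val a g}"
      unfolding noninput using outputs[OF a] outputs_unique by fastforce
    moreover have "inj_on e {g \<in> G. (\<forall>i. lab g \<noteq> Input i) \<and> val a g}"
      using e by (rule inj_on_subset) auto
    ultimately show ?thesis
      using K[OF a] by (simp add: energy_at_def card_image)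
  qed
  ultimately show ?thesis
    using circuit by (intro EC_le)
qed

section \<open>Padded decision trees\<close>

text \<open>A node of the perfect binary tree is the list of the bits read on the way to it, latest bit
  first.\<close>

primrec path :: "(bool list \<Rightarrow> nat) \<Rightarrow> bool list \<Rightarrow> nat \<Rightarrow> bool list" where
  "path q a 0 = []"
| "path q a (Suc k) = (a ! q (path q a k)) # path q a k"

lemma length_path [simp]: "length (path q a k) = k"
  by (induction k) auto

text \<open>Leaves absorb all further bits, so every list is a node: this is the padding.\<close>

primrec subtree :: "dtree \<Rightarrow> bool list \<Rightarrow> dtree" where
  "subtree T [] = T"
| "subtree T (b # p) =
    (case subtree T p of Leaf c \<Rightarrow> Leaf c | Query i l r \<Rightarrow> if b then r else l)"

text \<open>Padding nodes query the dummy variable 0; both answers lead back to the same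
  leaf.\<close>

definition query_at :: "dtree \<Rightarrow> bool list \<Rightarrow> nat" where
  "query_at T p = (case subtree T p of Leaf c \<Rightarrow> 0 | Query i l r \<Rightarrow> i)"

definition leaf_at :: "dtree \<Rightarrow> bool list \<Rightarrow> bool" where
  "leaf_at T p = (case subtree T p of Leaf c \<Rightarrow> c | Query i l r \<Rightarrow> False)"

lemma depth_subtree: "dtree_depth (subtree T p) \<le> dtree_depth T - length p"
  by (induction p) (auto split: dtree.splits)

lemma queried_subtree: "queried (subtree T p) \<subseteq> queried T"
  by (induction p) (auto split: dtree.splits)

lemma query_at_less:
  assumes "queried T \<subseteq> {..<n}" "0 < n"
  shows "query_at T p < n"
  using queried_subtree[of T p] assms by (auto simp: query_at_def split: dtree.splits)

lemma dtree_eval_subtree_path: "dtree_eval (subtree T (path (query_at T) a k)) a = dtree_eval T a"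
  by (induction k) (auto simp: query_at_def split: dtree.splits)

lemma leaf_at_path: "leaf_at T (path (query_at T) a (dtree_depth T)) = dtree_eval T a"
proof -
  let ?S = "subtree T (path (query_at T) a (dtree_depth T))"
  \<comment> \<open>Only a leaf remains at this depth, so the default \<open>False\<close> of
    \<open>leaf_at\<close> is never read.\<close>
  have "dtree_depth ?S = 0"
    using depth_subtree[of T "path (query_at T) a (dtree_depth T)"] by simp
  then show ?thesis
    using dtree_eval_subtree_path[of T a "dtree_depth T"]
    by (cases ?S) (simp_all add: leaf_at_def)
qed

section \<open>The circuit of a padded decision tree\<close>

text \<open>\<open>Reach p\<close> tests whether \<open>p\<close> is on the path of the input; \<open>Collect k p\<close> tests in addition
  whether the bit read at level \<open>k\<close> is 1, where at level \<open>D\<close> the leaf label is read; \<open>Neg k\<close> negates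
  this bit.\<close>

datatype tree_gate =
  Var nat | NotVar | Zero | Reach "bool list" | Neg nat | Collect nat "bool list"

text \<open>\<open>Reach []\<close> is the constant 1, written as \<open>x\<^sub>1 \<or> \<not> x\<^sub>1\<close>.\<close>

fun tree_label ::
  "nat \<Rightarrow> (bool list \<Rightarrow> nat) \<Rightarrow> (bool list \<Rightarrow> bool) \<Rightarrow> tree_gate \<Rightarrow> tree_gate gate" where
  "tree_label D q L (Var i) = Input i"
| "tree_label D q L NotVar = Not_Gate (Var 0)"
| "tree_label D q L Zero = Not_Gate (Reach [])"
| "tree_label D q L (Reach []) = Or_Gate (Var 0) NotVar"
| "tree_label D q L (Reach (b # p)) =
    And_Gate (Reach p) (if b then Var (q p) else Neg (length p))"
| "tree_label D q L (Neg k) = Not_Gate (Collect k [])"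
| "tree_label D q L (Collect k p) =
    (if length p < k then Or_Gate (Collect k (False # p)) (Collect k (True # p))
     else And_Gate (Reach p) (if k < D then Var (q p) else if L p then Reach p else Zero))"

primrec tree_value ::
  "nat \<Rightarrow> (bool list \<Rightarrow> nat) \<Rightarrow> (bool list \<Rightarrow> bool) \<Rightarrow> bool list \<Rightarrow> tree_gate \<Rightarrow> bool" where
  "tree_value D q L a (Var i) = a ! i"
| "tree_value D q L a NotVar = (\<not> a ! 0)"
| "tree_value D q L a Zero = False"
| "tree_value D q L a (Reach p) = (p = path q a (length p))"
| "tree_value D q L a (Neg k) = (\<not> a ! q (path q a k))"
| "tree_value D q L a (Collect k p) =
    (p = path q a (length p) \<and> (if k < D then a ! q (path q a k) else L (path q a k)))"

text \<open>Levels are spaced \<open>D + 4\<close> apart. Level \<open>k\<close> starts with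
  \<open>Reach\<close>, then \<open>Collect k\<close> from the deepest nodes up, then
  \<open>Neg k\<close>; as \<open>k < D\<close> there, this stays below \<open>Reach\<close> of the
  next level. \<open>Zero\<close> fits between \<open>Reach []\<close> and all
  \<open>Collect\<close> gates.\<close>

primrec tree_rank :: "nat \<Rightarrow> tree_gate \<Rightarrow> nat" where
  "tree_rank D (Var i) = 0"
| "tree_rank D NotVar = 1"
| "tree_rank D Zero = 3"
| "tree_rank D (Reach p) = (D + 4) * length p + 2"
| "tree_rank D (Neg k) = (D + 4) * k + k + 5"
| "tree_rank D (Collect k p) = (D + 4) * k + (k - length p) + 4"

definition tree_gates :: "nat \<Rightarrow> nat \<Rightarrow> tree_gate set" where
  "tree_gates n D = Var ` {..<n} \<union> {NotVar, Zero} \<union> Reach ` {p. length p \<le> D} \<union> Neg ` {..<D}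
    \<union> (\<lambda>(k, p). Collect k p) ` {(k, p). length p \<le> k \<and> k \<le> D}"

lemma finite_tree_gates: "finite (tree_gates n D)"
proof -
  have fin: "finite {p :: bool list. length p \<le> D}"
    using finite_lists_length_le[of "UNIV :: bool set" D] by simp
  have "finite {(k, p :: bool list). length p \<le> k \<and> k \<le> D}"
    by (rule finite_subset[of _ "{..D} \<times> {p. length p \<le> D}"]) (use fin in auto)
  with fin show ?thesis
    by (simp add: tree_gates_def)
qed

lemma tree_gates_closed:
  assumes "g \<in> tree_gates n D" "h \<in> preds (tree_label D q L g)" "\<And>p. q p < n" "0 < n"
  shows "h \<in> tree_gates n D"
  using assms
  by (cases "(D, q, L, g)" rule: tree_label.cases)
    (auto simp: tree_gates_def image_iff split: if_splits)

lemma tree_rank_less: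
  assumes "g \<in> tree_gates n D" "h \<in> preds (tree_label D q L g)"
  shows "tree_rank D h < tree_rank D g"
  using assms
  by (cases "(D, q, L, g)" rule: tree_label.cases)
    (auto simp: tree_gates_def image_iff split: if_splits)

text \<open>A node on the path has exactly one child on it, which justifies the disjunctions in
  \<open>Collect\<close>. \<open>Neg k\<close> serves its whole level because the conjunction with
  \<open>Reach p\<close> lets it matter only when \<open>p\<close> is the path node.\<close>

lemma tree_value_gate_value:
  assumes "g \<in> tree_gates n D"
  shows "tree_value D q L a g = gate_value a (tree_value D q L a) (tree_label D q L g)"
  using assms
  by (cases "(D, q, L, g)" rule: tree_label.cases)
    (auto simp: tree_gates_def image_iff)

text \<open>Apart from \<open>NotVar\<close> and the gates \<open>Neg k\<close>, an active gate
  carries a node of the path; the two levels indexing \<open>Collect\<close> give the quadratic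
  term.\<close>

lemma card_active_tree_gates:
  "card {g \<in> tree_gates n D. (\<forall>i. tree_label D q L g \<noteq> Input i) \<and> tree_value D q L a g}
    \<le> 8 * max 1 D ^ 2"
proof -
  let ?R = "(\<lambda>l. Reach (path q a l)) ` {..D}" and ?N = "Neg ` {..<D}"
    and ?C = "(\<lambda>(k, l). Collect k (path q a l)) ` ({..D} \<times> {..D})"
  have "{g \<in> tree_gates n D. (\<forall>i. tree_label D q L g \<noteq> Input i) \<and> tree_value D q L a g}
      \<subseteq> {NotVar} \<union> ?R \<union> ?N \<union> ?C"
    by (auto simp: tree_gates_def image_iff)
  then have "card {g \<in> tree_gates n D. (\<forall>i. tree_label D q L g \<noteq> Input i) \<and> tree_value D q L a g}
      \<le> card ({NotVar} \<union> ?R \<union> ?N \<union> ?C)"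
    by (intro card_mono) auto
  also have "\<dots> \<le> card {NotVar} + card ?R + card ?N + card ?C"
    by (meson add_mono card_Un_le order.refl order.trans)
  also have "\<dots> \<le> 1 + (D + 1) + D + (D + 1) * (D + 1)"
    using card_image_le[of "{..D}" "\<lambda>l. Reach (path q a l)"] card_image_le[of "{..<D}" Neg]
      card_image_le[of "{..D} \<times> {..D}" "\<lambda>(k, l). Collect k (path q a l)"]
    by (intro add_mono) (auto simp: card_cartesian_product)
  \<comment> \<open>The sum is \<open>D^2 + 4 * D + 3\<close>, which is 8 at \<open>D = 1\<close>;
    hence the constant.\<close>
  also have "\<dots> \<le> 8 * max 1 D ^ 2"
  proof (cases "D = 0")
    case False
    then have "1 \<le> D" "D \<le> D * D" by auto
    then have "1 + (D + 1) + D + (D + 1) * (D + 1) \<le> 8 * (D * D)"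
      unfolding distrib_left distrib_right by linarith
    with \<open>1 \<le> D\<close> show ?thesis by (simp add: max_def power2_eq_square)
  qed simp
  finally show ?thesis .
qed

lemma EC_le_depth:
  assumes T: "dtree_computes n T f" and n: "0 < n"
  shows "EC n f \<le> 8 * max 1 (dtree_depth T) ^ 2"
proof -
  let ?D = "dtree_depth T" and ?q = "query_at T" and ?L = "leaf_at T"
  have q: "?q p < n" for p
    using T n query_at_less by (simp add: dtree_computes_def)
  show ?thesis
  proof (rule EC_le_card_gates[where G = "tree_gates n ?D" and lab = "tree_label ?D ?q ?L"
        and rank = "tree_rank ?D" and val = "tree_value ?D ?q ?L" and r = "Collect ?D []"])
    show "i < n" if "g \<in> tree_gates n ?D" "tree_label ?D ?q ?L g = Input i" for g i
      using that by (cases "(?D, ?q, ?L, g)" rule: tree_label.cases)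
        (auto simp: tree_gates_def split: if_splits)
    \<comment> \<open>Only \<open>Neg k\<close> reads \<open>Collect k []\<close>, and
      \<open>Neg\<close> stops below level \<open>?D\<close>.\<close>
    show "Collect ?D [] \<notin> preds (tree_label ?D ?q ?L g)" if "g \<in> tree_gates n ?D" for g
      using that by (cases "(?D, ?q, ?L, g)" rule: tree_label.cases)
        (auto simp: tree_gates_def split: if_splits)
    show "tree_value ?D ?q ?L a (Collect ?D []) = f a" if "a \<in> cube n" for a
      using that T by (simp add: leaf_at_path dtree_computes_def)
  qed (use finite_tree_gates tree_gates_closed[OF _ _ q n] tree_rank_less tree_value_gate_value
      card_active_tree_gates in \<open>auto simp: tree_gates_def split: if_splits\<close>)
qed

section \<open>Existence of decision trees\<close>

lemma ex_dtree_of_dependency: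
  assumes "k \<le> n"
    and "\<And>a b. a \<in> cube n \<Longrightarrow> b \<in> cube n \<Longrightarrow> (\<And>i. i < k \<Longrightarrow> a ! i = b ! i) \<Longrightarrow> f a = f b"
  shows "\<exists>T. queried T \<subseteq> {..<k} \<and> (\<forall>a\<in>cube n. dtree_eval T a = f a)"
  using assms
proof (induction k arbitrary: f)
  case 0
  obtain a where a: "a \<in> cube n" using cube_nonempty by blast
  have "f a = f b" if "b \<in> cube n" for b
    using a that by (rule "0.prems"(2)) simp
  then show ?case
    by (intro exI[of _ "Leaf (f a)"]) simp
next
  case (Suc k)
  \<comment> \<open>Overwriting position \<open>k\<close> removes the dependence on it and keeps
    inputs in \<open>cube n\<close>, so \<open>n\<close> stays fixed in the induction.\<close>
  have "\<exists>T. queried T \<subseteq> {..<k} \<and> (\<forall>a\<in>cube n. dtree_eval T a = f (a[k := c]))" for c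
  proof (rule Suc.IH)
    fix a b assume "a \<in> cube n" "b \<in> cube n" "\<And>i. i < k \<Longrightarrow> a ! i = b ! i"
    then show "f (a[k := c]) = f (b[k := c])"
      using Suc.prems(1)
      by (intro Suc.prems(2)) (auto simp: cube_def nth_list_update less_Suc_eq)
  qed (use Suc.prems in simp)
  then obtain T where T: "\<And>c. queried (T c) \<subseteq> {..<k}"
    "\<And>c a. a \<in> cube n \<Longrightarrow> dtree_eval (T c) a = f (a[k := c])"
    by metis
  have "dtree_eval (Query k (T False) (T True)) a = f a" if "a \<in> cube n" for a
    using T(2)[OF that, of "a ! k"] by (cases "a ! k") (metis dtree_eval.simps(2) list_update_id)+
  moreover have "queried (Query k (T False) (T True)) \<subseteq> {..<Suc k}"
    using T(1) by (force simp: less_Suc_eq)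
  ultimately show ?case by blast
qed

lemma DT_attained: "\<exists>T. dtree_computes n T f \<and> dtree_depth T = DT n f"
proof -
  have "\<exists>T. queried T \<subseteq> {..<n} \<and> (\<forall>a\<in>cube n. dtree_eval T a = f a)"
  proof (rule ex_dtree_of_dependency)
    fix a b assume "a \<in> cube n" "b \<in> cube n" "\<And>i. i < n \<Longrightarrow> a ! i = b ! i"
    then have "a = b" by (auto simp: cube_def intro: nth_equalityI)
    then show "f a = f b" by simp
  qed simp
  then have "\<exists>d T. dtree_computes n T f \<and> dtree_depth T = d"
    by (auto simp: dtree_computes_def)
  then show ?thesis
    unfolding DT_def by (rule LeastI_ex)
qed

theorem theorem1p1:
  shows "\<exists>c::real. c > 0 \<and>
    (\<forall>n\<ge>1. \<forall>f :: bool list \<Rightarrow> bool. real (EC n f) \<le> c * real (max 1 (DT n f)) ^ 3)"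
proof (intro exI[of _ 8] conjI allI impI)
  fix n :: nat and f :: "bool list \<Rightarrow> bool"
  assume "1 \<le> n"
  obtain T where "dtree_computes n T f" "dtree_depth T = DT n f"
    using DT_attained by blast
  then have "EC n f \<le> 8 * max 1 (DT n f) ^ 2"
    using EC_le_depth[of n T f] \<open>1 \<le> n\<close> by simp
  \<comment> \<open>The quadratic bound is more than required; the base is at least 1, so the
    exponent may grow.\<close>
  also have "\<dots> \<le> 8 * max 1 (DT n f) ^ 3"
    by (intro mult_left_mono power_increasing) auto
  finally have "real (EC n f) \<le> real (8 * max 1 (DT n f) ^ 3)"
    by (rule of_nat_mono)
  then show "real (EC n f) \<le> 8 * real (max 1 (DT n f)) ^ 3"
    by simp
qed simp

end
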